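(* (Local maximum principle for $\widehat K_\Gamma$.) Let $K$ be a compact set in $\mathbb{C}^k$ and let $U\Subset\mathbb{C}^k$ be an open set. Then for every $v\in\overline{\mathcal P}_\Gamma$ and every $x\in U\cap\widehat K_\Gamma$, $$v(x)\le\sup_{(\partial U\cap\widehat K_\Gamma)\cup(U\cap K)}v .$$
   Context: For every $z\in\mathbb{C}^k$, $\Gamma_z$ is a closed cone of $(1,0)$-vectors at $z$ containing non-zero vectors, and $\Gamma:=\bigcup_{z}\Gamma_z$ is closed (in the $(1,0)$-tangent bundle). Define $$\mathcal P_\Gamma:=\{u\in\mathcal C^2(\mathbb{C}^k):\ \langle i\partial\overline\partial u(z), i\xi_z\wedge\bar\xi_z\rangle\ge 0\ \text{for every } z \text{ and every } \xi_z\in\Gamma_z\},$$ and let $\overline{\mathcal P}_\Gamma$ be the set of functions which are pointwise limits of decreasing sequences of functions in $\mathcal P_\Gamma$. The hull of a compact $K$ is $$\widehat K_\Gamma:=\{z\in\mathbb{C}^k:\ u(z)\le\sup_K u\ \text{for every } u\in\mathcal P_\Gamma\}.$$ *)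

theory Defs
  imports "HOL-Analysis.Analysis"
begin

definition C2 :: "('a::real_normed_vector \<Rightarrow> 'b::real_normed_vector) \<Rightarrow> bool" where
  "C2 u \<longleftrightarrow>
     (\<exists>(Du :: 'a \<Rightarrow> 'a \<Rightarrow>\<^sub>L 'b) (D2u :: 'a \<Rightarrow> 'a \<Rightarrow>\<^sub>L ('a \<Rightarrow>\<^sub>L 'b)).
        (\<forall>z. (u has_derivative blinfun_apply (Du z)) (at z)) \<and>
        (\<forall>z. (Du has_derivative blinfun_apply (D2u z)) (at z)) \<and>
        continuous_on UNIV D2u)"

text \<open>
  The Wirtinger operators \<open>\<partial>/\<partial>z\<^sub>j = (\<partial>/\<partial>x\<^sub>j - i \<partial>/\<partial>y\<^sub>j)/2\<close> and
  \<open>\<partial>/\<partial>(cnj z\<^sub>j) = (\<partial>/\<partial>x\<^sub>j + i \<partial>/\<partial>y\<^sub>j)/2\<close>. The real coordinate directions \<open>x\<^sub>j\<close> and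
  \<open>y\<^sub>j\<close> are \<open>axis j 1\<close> and \<open>axis j \<i>\<close>.
\<close>

definition dz :: "'k::finite \<Rightarrow> (complex^'k \<Rightarrow> complex) \<Rightarrow> complex^'k \<Rightarrow> complex" where
  "dz j f z = (frechet_derivative f (at z) (axis j 1)
               - \<i> * frechet_derivative f (at z) (axis j \<i>)) / 2"

definition dzbar :: "'k::finite \<Rightarrow> (complex^'k \<Rightarrow> complex) \<Rightarrow> complex^'k \<Rightarrow> complex" where
  "dzbar j f z = (frechet_derivative f (at z) (axis j 1)
                  + \<i> * frechet_derivative f (at z) (axis j \<i>)) / 2"

text \<open>
  A (1,0)-vector \<open>\<Sum>\<^sub>j \<xi>\<^sub>j \<partial>/\<partial>z\<^sub>j\<close> at \<open>z\<close> is identified with \<open>\<xi> \<in> \<complex>\<^sup>k\<close>. The pairing of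
  the (1,1)-form \<open>i ddbar u\<close> at \<open>z\<close> with \<open>i \<xi> \<and> cnj \<xi>\<close> is
  \<open>\<Sum>\<^sub>j\<^sub>,\<^sub>l (\<partial>\<^sup>2u/\<partial>z\<^sub>j\<partial>(cnj z\<^sub>l))(z) \<xi>\<^sub>j cnj \<xi>\<^sub>l\<close>, with the usual sign normalization (a plurisubharmonic
  \<open>u\<close> has non-negative pairings). The sum is real for \<open>u\<close> of class \<open>C\<^sup>2\<close>, so \<open>Re\<close> only
  changes its type.
\<close>

definition ddbar_pairing :: "(complex^'k::finite \<Rightarrow> real) \<Rightarrow> complex^'k \<Rightarrow> complex^'k \<Rightarrow> real" where
  "ddbar_pairing u z \<xi> =
     Re (\<Sum>j\<in>UNIV. \<Sum>l\<in>UNIV. dz j (dzbar l (\<lambda>w. of_real (u w))) z * \<xi> $ j * cnj (\<xi> $ l))"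

text \<open>
  \<open>cone\<close> is the library's notion: stability under multiplication by reals \<open>c \<ge> 0\<close>. It covers
  the complex cones as a special case.
\<close>

definition closed_cone_family :: "(complex^'k::finite \<Rightarrow> (complex^'k) set) \<Rightarrow> bool" where
  "closed_cone_family \<Gamma> \<longleftrightarrow>
     (\<forall>z. closed (\<Gamma> z) \<and> cone (\<Gamma> z) \<and> (\<exists>\<xi>\<in>\<Gamma> z. \<xi> \<noteq> 0)) \<and>
     closed {(z, \<xi>). \<xi> \<in> \<Gamma> z}"

definition psh_class :: "(complex^'k::finite \<Rightarrow> (complex^'k) set) \<Rightarrow> (complex^'k \<Rightarrow> real) set" where
  "psh_class \<Gamma> = {u. C2 u \<and> (\<forall>z. \<forall>\<xi>\<in>\<Gamma> z. 0 \<le> ddbar_pairing u z \<xi>)}"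

text \<open>
  A decreasing limit may take the value \<open>-\<infinity>\<close>, hence \<open>ereal\<close>. Decreasing means non-increasing.
\<close>

definition psh_class_closure ::
    "(complex^'k::finite \<Rightarrow> (complex^'k) set) \<Rightarrow> (complex^'k \<Rightarrow> ereal) set" where
  "psh_class_closure \<Gamma> =
     {v. \<exists>u :: nat \<Rightarrow> complex^'k \<Rightarrow> real.
           (\<forall>n. u n \<in> psh_class \<Gamma>) \<and>
           (\<forall>z. decseq (\<lambda>n. u n z)) \<and>
           (\<forall>z. (\<lambda>n. ereal (u n z)) \<longlonglongrightarrow> v z)}"

text \<open>Suprema are taken in \<open>ereal\<close>, so the supremum over the empty set is \<open>-\<infinity>\<close>.\<close>

definition hull_of :: "(complex^'k::finite \<Rightarrow> (complex^'k) set) \<Rightarrow> (complex^'k) set \<Rightarrow> (complex^'k) set" where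
  "hull_of \<Gamma> K = {z. \<forall>u\<in>psh_class \<Gamma>. ereal (u z) \<le> (SUP w\<in>K. ereal (u w))}"

end

theory Submission
  imports Defs
begin

text \<open>
  A function in the closure is replaced by a member \<open>u\<close> of its approximating sequence: if the
  principle fails, then by compactness some such \<open>u\<close> satisfies
  \<open>u < c\<close> on \<open>(\<partial>U \<inter> hull) \<union> (U \<inter> K)\<close> but \<open>u x > c\<close>. Let \<open>\<chi>\<close> be convex of class \<open>C\<^sup>2\<close>,
  zero on the negative half-line, positive on the positive one, with \<open>0 \<le> \<chi>' \<le> 1\<close>.
  Points of \<open>\<partial>U\<close> where \<open>u \<ge> c\<close> lie outside the hull, so a large multiple of a finite sum of
  functions \<open>\<chi> \<circ> u\<^sub>i\<close> yields \<open>\<psi> \<ge> 0\<close> in the class, zero on the hull, with \<open>u - c < \<psi>\<close> on \<open>\<partial>U\<close>.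
  Then \<open>w = \<psi> + \<chi> (u - c - \<psi>)\<close> inside \<open>U\<close>, \<open>w = \<psi>\<close> outside, is a regularized maximum of
  \<open>\<psi>\<close> and \<open>u - c\<close> which belongs to the class, vanishes on \<open>K\<close> and is positive at \<open>x\<close>; this
  contradicts the definition of the hull.
\<close>

section \<open>Explicit derivatives and the pairing in real coordinates\<close>

text \<open>The derivatives are named because positivity is a condition on \<open>D2u\<close> that
  has to be followed through sums, compositions and gluing.\<close>

definition C2_derivs ::
    "('a::real_normed_vector \<Rightarrow> 'b::real_normed_vector) \<Rightarrow> ('a \<Rightarrow> 'a \<Rightarrow>\<^sub>L 'b) \<Rightarrow>
     ('a \<Rightarrow> 'a \<Rightarrow>\<^sub>L ('a \<Rightarrow>\<^sub>L 'b)) \<Rightarrow> bool" where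
  "C2_derivs u Du D2u \<longleftrightarrow>
     (\<forall>z. (u has_derivative blinfun_apply (Du z)) (at z)) \<and>
     (\<forall>z. (Du has_derivative blinfun_apply (D2u z)) (at z)) \<and> continuous_on UNIV D2u"

lemma C2_iff_C2_derivs: "C2 u \<longleftrightarrow> (\<exists>Du D2u. C2_derivs u Du D2u)"
  unfolding C2_def C2_derivs_def ..

lemma complex_vec_expansion:
  fixes \<xi> :: "complex^'k::finite"
  shows "\<xi> = (\<Sum>j\<in>UNIV. Re (\<xi> $ j) *\<^sub>R axis j 1 + Im (\<xi> $ j) *\<^sub>R axis j \<i>)"
proof -
  have "(\<Sum>j\<in>UNIV. (Re (\<xi> $ j) *\<^sub>R axis j 1 + Im (\<xi> $ j) *\<^sub>R axis j \<i>) $ i) = \<xi> $ i" for i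
  proof -
    have "(\<Sum>j\<in>UNIV. (Re (\<xi> $ j) *\<^sub>R axis j 1 + Im (\<xi> $ j) *\<^sub>R axis j \<i> :: complex^'k) $ i)
        = (\<Sum>j\<in>UNIV. if j = i then \<xi> $ j else 0)"
      by (intro sum.cong) (auto simp: axis_def complex_eq_iff)
    then show ?thesis by simp
  qed
  then show ?thesis by (simp add: vec_eq_iff)
qed

text \<open>Both sides expand over the real basis into the same terms in \<open>j\<close> and
  \<open>l\<close>. The right side is a quarter of the Laplacian at \<open>t = 0\<close> of
  \<open>u (z + t *s \<xi>)\<close> in one complex variable \<open>t\<close>.\<close>

lemma ddbar_pairing_eq:
  fixes u :: "complex^'k::finite \<Rightarrow> real"
  assumes "C2_derivs u Du D2u"
  shows "ddbar_pairing u z \<xi> =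
    (D2u z \<xi> \<xi> + D2u z (\<i> *s \<xi>) (\<i> *s \<xi>)) / 4"
proof -
  note du = assms[unfolded C2_derivs_def, THEN conjunct1, rule_format]
  note d2u = assms[unfolded C2_derivs_def, THEN conjunct2, THEN conjunct1, rule_format]
  \<comment> \<open>The first argument of \<open>B\<close> is the direction in which
    \<open>Du\<close> is differentiated; \<open>a j\<close> and \<open>b j\<close> are the
    directions of the real and imaginary part of the j-th coordinate.\<close>
  define B where "B = (\<lambda>a b. D2u z a b)"
  define a :: "'k \<Rightarrow> complex^'k" where "a = (\<lambda>j. axis j 1)"
  define b :: "'k \<Rightarrow> complex^'k" where "b = (\<lambda>j. axis j \<i>)"
  define p where "p = (\<lambda>j. Re (\<xi> $ j))"
  define q where "q = (\<lambda>j. Im (\<xi> $ j))"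
  have dzbar: "dzbar l (\<lambda>w. of_real (u w)) = (\<lambda>w. (of_real (Du w (a l)) + \<i> * of_real (Du w (b l))) / 2)" for l
  proof
    fix w
    have "((\<lambda>w. complex_of_real (u w)) has_derivative (\<lambda>h. of_real (Du w h))) (at w)"
      by (intro has_derivative_of_real du)
    from frechet_derivative_at[OF this, symmetric]
    show "dzbar l (\<lambda>w. of_real (u w)) w = (of_real (Du w (a l)) + \<i> * of_real (Du w (b l))) / 2"
      by (simp add: dzbar_def a_def b_def)
  qed
  have dz: "dz j (dzbar l (\<lambda>w. of_real (u w))) z =
      ((of_real (B (a j) (a l)) + \<i> * of_real (B (a j) (b l)))
        - \<i> * (of_real (B (b j) (a l)) + \<i> * of_real (B (b j) (b l)))) / 4" for j l
  proof -
    have "((\<lambda>w. (complex_of_real (Du w (a l)) + \<i> * of_real (Du w (b l))) / 2) has_derivative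
       (\<lambda>h. (of_real (D2u z h (a l)) + \<i> * of_real (D2u z h (b l))) / 2)) (at z)"
      by (auto intro!: derivative_eq_intros d2u simp: blinfun.bilinear_simps)
    from frechet_derivative_at[OF this, symmetric]
    show ?thesis
      unfolding dzbar by (simp add: dz_def a_def b_def B_def field_simps)
  qed
  have summand: "Re (dz j (dzbar l (\<lambda>w. of_real (u w))) z * \<xi> $ j * cnj (\<xi> $ l)) =
     ((p j * p l + q j * q l) * (B (a j) (a l) + B (b j) (b l))
      + (p j * q l - q j * p l) * (B (a j) (b l) - B (b j) (a l))) / 4" for j l
    unfolding dz p_def q_def by (simp add: field_simps)
  have e1: "\<xi> = (\<Sum>j\<in>UNIV. p j *\<^sub>R a j + q j *\<^sub>R b j)"
    unfolding p_def q_def a_def b_def by (rule complex_vec_expansion)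
  have e2: "\<i> *s \<xi> = (\<Sum>j\<in>UNIV. (- q j) *\<^sub>R a j + p j *\<^sub>R b j)"
    using complex_vec_expansion[of "\<i> *s \<xi>"] unfolding p_def q_def a_def b_def by simp
  have bil: "B (\<Sum>j\<in>UNIV. r j *\<^sub>R a j + s j *\<^sub>R b j) (\<Sum>l\<in>UNIV. r l *\<^sub>R a l + s l *\<^sub>R b l)
     = (\<Sum>j\<in>UNIV. \<Sum>l\<in>UNIV. r j * r l * B (a j) (a l) + r j * s l * B (a j) (b l)
           + s j * r l * B (b j) (a l) + s j * s l * B (b j) (b l))" for r s :: "'k \<Rightarrow> real"
    unfolding B_def blinfun.sum_left blinfun.sum_right
    by (subst sum.swap, intro sum.cong refl) (simp add: blinfun.bilinear_simps algebra_simps)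
  have "B \<xi> \<xi> + B (\<i> *s \<xi>) (\<i> *s \<xi>) = (\<Sum>j\<in>UNIV. \<Sum>l\<in>UNIV. 
      (p j * p l + q j * q l) * (B (a j) (a l) + B (b j) (b l))
      + (p j * q l - q j * p l) * (B (a j) (b l) - B (b j) (a l)))"
  proof -
    have "B \<xi> \<xi> = B (\<Sum>j\<in>UNIV. p j *\<^sub>R a j + q j *\<^sub>R b j) (\<Sum>l\<in>UNIV. p l *\<^sub>R a l + q l *\<^sub>R b l)"
      using e1 by metis
    then show ?thesis
      unfolding e2 bil
      by (simp only: sum.distrib[symmetric], intro sum.cong refl, simp add: algebra_simps)
  qed
  then show ?thesis
    unfolding ddbar_pairing_def Re_sum summand B_def by (simp add: sum_divide_distrib)
qed

lemma psh_class_iff: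
  "u \<in> psh_class \<Gamma> \<longleftrightarrow> (\<exists>Du D2u. C2_derivs u Du D2u \<and>
     (\<forall>z. \<forall>\<xi>\<in>\<Gamma> z. 0 \<le> D2u z \<xi> \<xi> + D2u z (\<i> *s \<xi>) (\<i> *s \<xi>)))"
  unfolding psh_class_def C2_iff_C2_derivs by (force simp: ddbar_pairing_eq)

section \<open>Constants, sums and non-negative multiples in the class\<close>

lemma psh_class_const: "(\<lambda>z. c) \<in> psh_class \<Gamma>"
  unfolding psh_class_iff C2_derivs_def
  by (rule exI[of _ "\<lambda>z. 0"], rule exI[of _ "\<lambda>z. 0"]) (auto simp: zero_blinfun.rep_eq)

lemma C2_derivs_add:
  assumes "C2_derivs u Du D2u" "C2_derivs v Dv D2v"
  shows "C2_derivs (\<lambda>z. u z + v z) (\<lambda>z. Du z + Dv z) (\<lambda>z. D2u z + D2v z)"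
  using assms unfolding C2_derivs_def plus_blinfun.rep_eq
  by (intro conjI allI has_derivative_add continuous_on_add) auto

lemma C2_derivs_scale:
  assumes "C2_derivs u Du D2u"
  shows "C2_derivs (\<lambda>z. c *\<^sub>R u z) (\<lambda>z. c *\<^sub>R Du z) (\<lambda>z. c *\<^sub>R D2u z)"
  using assms unfolding C2_derivs_def scaleR_blinfun.rep_eq
  by (intro conjI allI has_derivative_scaleR_right continuous_on_scaleR continuous_on_const) auto

lemma psh_class_add:
  assumes "u \<in> psh_class \<Gamma>" "v \<in> psh_class \<Gamma>"
  shows "(\<lambda>z. u z + v z) \<in> psh_class \<Gamma>"
proof -
  from assms obtain Du D2u Dv D2v where
    u: "C2_derivs u Du D2u" "\<forall>z. \<forall>\<xi>\<in>\<Gamma> z. 0 \<le> D2u z \<xi> \<xi> + D2u z (\<i> *s \<xi>) (\<i> *s \<xi>)" and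
    v: "C2_derivs v Dv D2v" "\<forall>z. \<forall>\<xi>\<in>\<Gamma> z. 0 \<le> D2v z \<xi> \<xi> + D2v z (\<i> *s \<xi>) (\<i> *s \<xi>)"
    unfolding psh_class_iff by blast
  have "0 \<le> (D2u z + D2v z) \<xi> \<xi> + (D2u z + D2v z) (\<i> *s \<xi>) (\<i> *s \<xi>)" if "\<xi> \<in> \<Gamma> z" for z \<xi>
    using u(2)[rule_format, OF that] v(2)[rule_format, OF that] by (simp add: plus_blinfun.rep_eq)
  then show ?thesis
    unfolding psh_class_iff using C2_derivs_add[OF u(1) v(1)] by blast
qed

lemma psh_class_scale:
  assumes "u \<in> psh_class \<Gamma>" "0 \<le> c"
  shows "(\<lambda>z. c * u z) \<in> psh_class \<Gamma>"
proof -
  from assms obtain Du D2u where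
    u: "C2_derivs u Du D2u" "\<forall>z. \<forall>\<xi>\<in>\<Gamma> z. 0 \<le> D2u z \<xi> \<xi> + D2u z (\<i> *s \<xi>) (\<i> *s \<xi>)"
    unfolding psh_class_iff by blast
  have "0 \<le> (c *\<^sub>R D2u z) \<xi> \<xi> + (c *\<^sub>R D2u z) (\<i> *s \<xi>) (\<i> *s \<xi>)" if "\<xi> \<in> \<Gamma> z" for z \<xi>
    using u(2)[rule_format, OF that] assms(2)
    by (simp add: scaleR_blinfun.rep_eq distrib_left[symmetric])
  then show ?thesis
    unfolding psh_class_iff using C2_derivs_scale[OF u(1), of c] by (auto simp: real_scaleR_def)
qed

lemma psh_class_sum:
  assumes "\<And>i. i \<in> I \<Longrightarrow> u i \<in> psh_class \<Gamma>"
  shows "(\<lambda>z. \<Sum>i\<in>I. u i z) \<in> psh_class \<Gamma>"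
  using assms by (induction I rule: infinite_finite_induct) (auto intro: psh_class_const psh_class_add)

lemma psh_class_continuous:
  assumes "u \<in> psh_class \<Gamma>"
  shows "continuous_on A u"
  using assms unfolding psh_class_iff C2_derivs_def
  by (meson continuous_at_imp_continuous_on has_derivative_continuous)

section \<open>The convex cut-off function\<close>

text \<open>
  The choice \<open>t - arctan t\<close> (rather than a power of \<open>t\<close>) keeps the derivative in \<open>[0, 1]\<close>, which
  makes \<open>\<psi> + \<chi> (g - \<psi>)\<close> a combination of \<open>\<psi>\<close> and \<open>g\<close> with non-negative weights to second order.
\<close>

definition chi :: "real \<Rightarrow> real" where
  "chi t = (if t \<le> 0 then 0 else t - arctan t)"

definition chi' :: "real \<Rightarrow> real" where
  "chi' t = (if t \<le> 0 then 0 else 1 - inverse (1 + t\<^sup>2))"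

definition chi'' :: "real \<Rightarrow> real" where
  "chi'' t = (if t \<le> 0 then 0 else 2 * t * (inverse (1 + t\<^sup>2))\<^sup>2)"

text \<open>Both branches have value and derivative 0 at the origin, so the pieces on the two
  half-lines fit together there. Using this for \<open>chi\<close> and again for \<open>chi'\<close>
  gives two derivatives.\<close>

lemma has_real_derivative_cutoff:
  fixes f f' :: "real \<Rightarrow> real"
  assumes "\<And>t. (f has_real_derivative f' t) (at t)" "f 0 = 0" "f' 0 = 0"
  shows "((\<lambda>t. if t \<le> 0 then 0 else f t) has_real_derivative (if t \<le> 0 then 0 else f' t)) (at t)"
proof -
  have un: "UNIV = {..0::real} \<union> {0<..}" by auto
  have cl: "closure {0<..} = {0::real..}" by simp
  have "((\<lambda>t. if t \<in> {..0} then 0 else f t) has_vector_derivative (if t \<in> {..0} then 0 else f' t)) (at t within UNIV)"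
    by (rule has_vector_derivative_If_within_closures[OF _ un])
      (use assms in \<open>auto simp: has_real_derivative_iff_has_vector_derivative cl
         intro!: has_vector_derivative_const intro: has_vector_derivative_at_within\<close>)
  then show ?thesis by (simp add: has_real_derivative_iff_has_vector_derivative)
qed

lemma one_plus_square_nz: "1 + t\<^sup>2 \<noteq> (0::real)"
  using zero_le_power2[of t] by linarith

lemma chi_deriv: "(chi has_real_derivative chi' t) (at t)"
  unfolding chi_def[abs_def] chi'_def
  by (rule has_real_derivative_cutoff) (auto intro!: derivative_eq_intros)

lemma chi'_deriv: "(chi' has_real_derivative chi'' t) (at t)"
  unfolding chi'_def[abs_def] chi''_def
  by (rule has_real_derivative_cutoff)
    (auto intro!: derivative_eq_intros simp: one_plus_square_nz, simp add: power2_eq_square)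

lemma chi''_continuous: "continuous_on A chi''"
proof -
  \<comment> \<open>The factor \<open>max 0 t\<close> vanishes on the negative half-line and so
    absorbs the case distinction into one visibly continuous formula.\<close>
  have eq: "chi'' = (\<lambda>t. 2 * max 0 t * (inverse (1 + (max 0 t)\<^sup>2))\<^sup>2)"
    by (auto simp: chi''_def fun_eq_iff max_def)
  show ?thesis
    unfolding eq by (intro continuous_intros ballI one_plus_square_nz)
qed

lemma chi_nonpos [simp]: "t \<le> 0 \<Longrightarrow> chi t = 0" "t \<le> 0 \<Longrightarrow> chi' t = 0" "t \<le> 0 \<Longrightarrow> chi'' t = 0"
  by (simp_all add: chi_def chi'_def chi''_def)

lemma chi_pos:
  assumes "0 < t"
  shows "0 < chi t"
proof -
  have "chi 0 < chi t"
  proof (rule DERIV_pos_imp_increasing_open[OF assms])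
    show "continuous_on {0..t} chi"
      by (rule DERIV_continuous_on[OF has_field_derivative_at_within[OF chi_deriv]])
    show "\<exists>y. (chi has_real_derivative y) (at x) \<and> 0 < y" if "0 < x" for x
      using that by (intro exI[of _ "chi' x"] conjI chi_deriv) (simp add: chi'_def inverse_less_1_iff)
  qed
  then show ?thesis by simp
qed

lemma chi_nonneg: "0 \<le> chi t"
  using chi_pos[of t] by (cases "t \<le> 0") auto

lemma chi'_bounds: "0 \<le> chi' t" "chi' t \<le> 1"
proof -
  have "inverse (1 + t\<^sup>2) \<le> 1" "0 \<le> inverse (1 + t\<^sup>2)"
    by (intro inverse_le_1_iff[THEN iffD2] disjI2) simp_all
  then show "0 \<le> chi' t" "chi' t \<le> 1" by (simp_all add: chi'_def)
qed

lemma chi''_nonneg: "0 \<le> chi'' t"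
  by (simp add: chi''_def)

section \<open>Extension by zero\<close>

text \<open>The open sets \<open>U\<close> and \<open>-F\<close> cover the space, and the extension
  is identically zero on \<open>-F\<close>. Every point, those of the frontier of \<open>U\<close>
  included, thus has a neighbourhood on which the extension is \<open>f\<close> or 0.\<close>

lemma has_derivative_extend_zero:
  assumes "open U" "closed F" "F \<subseteq> U"
    and "\<And>z. z \<in> U - F \<Longrightarrow> f z = 0"
    and "\<And>z. z \<in> U \<Longrightarrow> (f has_derivative blinfun_apply (f' z)) (at z)"
  shows "((\<lambda>z. if z \<in> U then f z else 0) has_derivative
           blinfun_apply (if z \<in> U then f' z else 0)) (at z)"
proof (cases "z \<in> U")
  case True
  then have "((\<lambda>z. if z \<in> U then f z else 0) has_derivative blinfun_apply (f' z)) (at z)"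
    by (rule has_derivative_transform_within_open[OF assms(5) \<open>open U\<close>]) (use True in auto)
  then show ?thesis using True by simp
next
  case False
  then have z: "z \<in> -F" using assms by auto
  have "((\<lambda>z. if z \<in> U then f z else 0) has_derivative blinfun_apply 0) (at z)"
    by (rule has_derivative_transform_within_open[of "\<lambda>_. 0", OF _ open_Compl[OF \<open>closed F\<close>] z])
      (use assms(4) in \<open>auto simp: zero_blinfun.rep_eq\<close>)
  then show ?thesis using False by simp
qed

lemma continuous_on_extend_zero:
  assumes "open U" "closed F" "F \<subseteq> U"
    and zero: "\<And>z. z \<in> U - F \<Longrightarrow> f z = 0"
    and "continuous_on U f"
  shows "continuous_on UNIV (\<lambda>z. if z \<in> U then f z else 0)"
proof -
  have "continuous_on U (\<lambda>z. if z \<in> U then f z else 0)"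
    using assms by (simp cong: continuous_on_cong)
  moreover have "continuous_on (-F) (\<lambda>z. if z \<in> U then f z else 0)"
    by (rule continuous_on_eq[of _ "\<lambda>_. 0"]) (use zero in auto)
  ultimately have "continuous_on (U \<union> -F) (\<lambda>z. if z \<in> U then f z else 0)"
    using assms by (intro continuous_on_open_Un) (auto simp: open_Compl)
  moreover have "U \<union> -F = UNIV" using assms by auto
  ultimately show ?thesis by simp
qed

lemma C2_derivs_extend_zero:
  assumes "open U" "closed F" "F \<subseteq> U"
    and "\<And>z. z \<in> U - F \<Longrightarrow> f z = 0 \<and> Df z = 0 \<and> D2f z = 0"
    and "C2_derivs f Df D2f"
  shows "C2_derivs (\<lambda>z. if z \<in> U then f z else 0) (\<lambda>z. if z \<in> U then Df z else 0)
           (\<lambda>z. if z \<in> U then D2f z else 0)"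
proof -
  have f: "\<And>z. (f has_derivative blinfun_apply (Df z)) (at z)"
    "\<And>z. (Df has_derivative blinfun_apply (D2f z)) (at z)" "continuous_on UNIV D2f"
    using assms(5) by (auto simp: C2_derivs_def)
  have zero: "f z = 0" "Df z = 0" "D2f z = 0" if "z \<in> U - F" for z
    using assms(4)[OF that] by auto
  note * = assms(1-3)
  show ?thesis
    unfolding C2_derivs_def
    using has_derivative_extend_zero[OF * zero(1) f(1)] has_derivative_extend_zero[OF * zero(2) f(2)]
      continuous_on_extend_zero[OF * zero(3) continuous_on_subset[OF f(3) subset_UNIV]]
    by blast
qed

section \<open>Composition with the cut-off and the regularized maximum\<close>

text \<open>The chain rule, twice. The composed operator sends \<open>a\<close> to
  \<open>Dh z a *\<^sub>R Dh z\<close>, so its quadratic form is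
  \<open>(Dh z a)\<^sup>2\<close>.\<close>

lemma C2_derivs_chi:
  assumes "C2_derivs h Dh D2h"
  shows "C2_derivs (\<lambda>z. chi (h z)) (\<lambda>z. chi' (h z) *\<^sub>R Dh z)
    (\<lambda>z. chi' (h z) *\<^sub>R D2h z + chi'' (h z) *\<^sub>R (blinfun_scaleR_left (Dh z) o\<^sub>L Dh z))"
proof -
  have dh: "(h has_derivative Dh z) (at z)" "(Dh has_derivative D2h z) (at z)"
    and cont_D2h: "continuous_on UNIV D2h" for z
    using assms by (auto simp: C2_derivs_def)
  have d1: "((\<lambda>z. chi (h z)) has_derivative (\<lambda>a. chi' (h z) * Dh z a)) (at z)" for z
    by (rule has_derivative_compose[OF dh(1) chi_deriv[unfolded has_field_derivative_def]])
  have d2: "((\<lambda>z. chi' (h z)) has_derivative (\<lambda>a. chi'' (h z) * Dh z a)) (at z)" for z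
    by (rule has_derivative_compose[OF dh(1) chi'_deriv[unfolded has_field_derivative_def]])
  have cont: "continuous_on UNIV h" "continuous_on UNIV Dh" "continuous_on UNIV (\<lambda>z. chi' (h z))"
    using has_derivative_continuous[OF dh(1)] has_derivative_continuous[OF dh(2)]
      has_derivative_continuous[OF d2]
    by (blast intro: continuous_at_imp_continuous_on)+
  have cont_chi'': "continuous_on UNIV (\<lambda>z. chi'' (h z))"
    by (rule continuous_on_compose2[OF chi''_continuous cont(1) subset_UNIV])
  let ?D = "\<lambda>z. chi' (h z) *\<^sub>R Dh z"
  let ?D2 = "\<lambda>z. chi' (h z) *\<^sub>R D2h z + chi'' (h z) *\<^sub>R (blinfun_scaleR_left (Dh z) o\<^sub>L Dh z)"
  have "((\<lambda>z. chi (h z)) has_derivative ?D z) (at z)" for z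
    using d1[of z] by (simp add: scaleR_blinfun.rep_eq)
  moreover have "(?D has_derivative ?D2 z) (at z)" for z
  proof (rule has_derivative_eq_rhs[OF has_derivative_scaleR[OF d2 dh(2)]])
    show "(\<lambda>a. chi' (h z) *\<^sub>R D2h z a + (chi'' (h z) * Dh z a) *\<^sub>R Dh z) = ?D2 z"
      by (simp add: fun_eq_iff plus_blinfun.rep_eq scaleR_blinfun.rep_eq)
  qed
  moreover have "continuous_on UNIV ?D2"
    by (intro continuous_on_add continuous_on_scaleR cont cont_chi'' cont_D2h
        bounded_bilinear.continuous_on[OF bounded_bilinear_blinfun_compose]
        bounded_linear.continuous_on[OF bounded_linear_blinfun_scaleR_left])
  ultimately show ?thesis by (simp add: C2_derivs_def)
qed

lemma psh_class_glue:
  fixes \<psi> g :: "complex^'k::finite \<Rightarrow> real"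
  assumes "\<psi> \<in> psh_class \<Gamma>" "g \<in> psh_class \<Gamma>" "open U"
    and lt: "\<And>z. z \<in> frontier U \<Longrightarrow> g z < \<psi> z"
  shows "(\<lambda>z. \<psi> z + (if z \<in> U then chi (g z - \<psi> z) else 0)) \<in> psh_class \<Gamma>"
proof -
  from assms obtain Dp D2p Dg D2g where
    p: "C2_derivs \<psi> Dp D2p" "\<forall>z. \<forall>\<xi>\<in>\<Gamma> z. 0 \<le> D2p z \<xi> \<xi> + D2p z (\<i> *s \<xi>) (\<i> *s \<xi>)" and
    g: "C2_derivs g Dg D2g" "\<forall>z. \<forall>\<xi>\<in>\<Gamma> z. 0 \<le> D2g z \<xi> \<xi> + D2g z (\<i> *s \<xi>) (\<i> *s \<xi>)"
    unfolding psh_class_iff by blast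
  define h where "h = (\<lambda>z. g z - \<psi> z)"
  define Dh where "Dh = (\<lambda>z. Dg z - Dp z)"
  define D2h where "D2h = (\<lambda>z. D2g z - D2p z)"
  \<comment> \<open>In \<open>U\<close> but off the closed set \<open>F\<close>, \<open>h\<close> is
    negative and the cut-off term vanishes. As \<open>h < 0\<close> on the frontier,
    \<open>F\<close> stays inside \<open>U\<close>, so the term can be extended by zero.\<close>
  define F where "F = closure U \<inter> {z. 0 \<le> h z}"
  have h: "C2_derivs h Dh D2h"
    using C2_derivs_add[OF g(1) C2_derivs_scale[OF p(1), of "-1"]]
    unfolding h_def Dh_def D2h_def by simp
  have "continuous_on UNIV h"
    unfolding h_def using assms by (intro continuous_intros psh_class_continuous)
  then have "closed F"
    unfolding F_def by (intro closed_Int closed_Collect_le) auto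
  moreover have "F \<subseteq> U"
    using lt \<open>open U\<close> by (force simp: F_def h_def frontier_def interior_open)
  moreover have "h z \<le> 0" if "z \<in> U - F" for z
    using that closure_subset[of U] by (auto simp: F_def)
  ultimately have k: "C2_derivs (\<lambda>z. if z \<in> U then chi (h z) else 0)
    (\<lambda>z. if z \<in> U then chi' (h z) *\<^sub>R Dh z else 0)
    (\<lambda>z. if z \<in> U then chi' (h z) *\<^sub>R D2h z + chi'' (h z) *\<^sub>R (blinfun_scaleR_left (Dh z) o\<^sub>L Dh z) else 0)"
    (is "C2_derivs ?k ?Dk ?D2k")
    using \<open>open U\<close> by (intro C2_derivs_extend_zero[OF _ _ _ _ C2_derivs_chi[OF h], of _ F]) auto
  have "C2_derivs (\<lambda>z. \<psi> z + ?k z) (\<lambda>z. Dp z + ?Dk z) (\<lambda>z. D2p z + ?D2k z)"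
    by (rule C2_derivs_add[OF p(1) k])
  moreover have "0 \<le> (D2p z + ?D2k z) \<xi> \<xi> + (D2p z + ?D2k z) (\<i> *s \<xi>) (\<i> *s \<xi>)" if "\<xi> \<in> \<Gamma> z" for z \<xi>
  proof (cases "z \<in> U")
    case True
    let ?L = "\<lambda>D. blinfun_apply (blinfun_apply D \<xi>) \<xi> + blinfun_apply (blinfun_apply D (\<i> *s \<xi>)) (\<i> *s \<xi>)"
    \<comment> \<open>Splitting \<open>D2h\<close> leaves the weights \<open>1 - chi'\<close> and
      \<open>chi'\<close> on \<open>\<psi>\<close> and \<open>g\<close>, both in [0, 1]; the
      rank-one part contributes squares with the factor \<open>chi'' \<ge> 0\<close>.\<close>
    have "(D2p z + ?D2k z) \<xi> \<xi> + (D2p z + ?D2k z) (\<i> *s \<xi>) (\<i> *s \<xi>) =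
       (1 - chi' (h z)) * ?L (D2p z) + chi' (h z) * ?L (D2g z)
       + chi'' (h z) * ((Dh z \<xi>)\<^sup>2 + (Dh z (\<i> *s \<xi>))\<^sup>2)"
      using True by (simp add: D2h_def blinfun.bilinear_simps algebra_simps power2_eq_square)
    also have "\<dots> \<ge> 0"
      using mult_nonneg_nonneg[OF _ p(2)[rule_format, OF that], of "1 - chi' (h z)"]
        mult_nonneg_nonneg[OF chi'_bounds(1) g(2)[rule_format, OF that]]
        mult_nonneg_nonneg[OF chi''_nonneg sum_power2_ge_zero] chi'_bounds(2)[of "h z"]
      by (intro add_nonneg_nonneg[OF add_nonneg_nonneg]) simp_all
    finally show ?thesis .
  next
    case False
    then show ?thesis using p(2) that by (simp add: blinfun.bilinear_simps)
  qed
  ultimately show ?thesis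
    unfolding psh_class_iff h_def by blast
qed

text \<open>This is gluing onto \<open>\<psi> = 0\<close> over the whole space, whose frontier is
  empty.\<close>

lemma psh_class_chi:
  assumes "u \<in> psh_class \<Gamma>"
  shows "(\<lambda>z. chi (u z)) \<in> psh_class \<Gamma>"
  using psh_class_glue[OF psh_class_const[of 0] assms open_UNIV] by simp

section \<open>The hull and separation of compact sets from it\<close>

lemma subset_hull_of: "K \<subseteq> hull_of \<Gamma> K"
  by (auto simp: hull_of_def intro: SUP_upper)

lemma closed_hull_of: "closed (hull_of \<Gamma> K)"
proof -
  have "hull_of \<Gamma> K = (\<Inter>u\<in>psh_class \<Gamma>. {z. ereal (u z) \<le> (SUP w\<in>K. ereal (u w))})"
    by (auto simp: hull_of_def)
  moreover have "closed {z. ereal (u z) \<le> (SUP w\<in>K. ereal (u w))}" if "u \<in> psh_class \<Gamma>" for u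
    using psh_class_continuous[OF that]
    by (intro closed_Collect_le continuous_on_ereal continuous_on_const)
  ultimately show ?thesis by auto
qed

text \<open>Each point off the hull has a member of the class that is positive there and
  non-positive on the hull. Composition with \<open>chi\<close> makes it vanish on the hull, and
  compactness leaves finitely many to add up.\<close>

lemma separate_from_hull:
  assumes "compact S" "S \<inter> hull_of \<Gamma> K = {}" "continuous_on S g"
  obtains \<psi> where "\<psi> \<in> psh_class \<Gamma>" "\<And>z. 0 \<le> \<psi> z"
    "\<And>z. z \<in> hull_of \<Gamma> K \<Longrightarrow> \<psi> z = 0" "\<And>z. z \<in> S \<Longrightarrow> g z < \<psi> z"
proof -
  have "\<exists>u\<in>psh_class \<Gamma>. 0 < u y \<and> (\<forall>z\<in>hull_of \<Gamma> K. u z \<le> 0)" if "y \<in> S" for y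
  proof -
    have "y \<notin> hull_of \<Gamma> K" using that assms by auto
    then obtain u where u: "u \<in> psh_class \<Gamma>" "(SUP w\<in>K. ereal (u w)) < ereal (u y)"
      by (auto simp: hull_of_def not_le)
    \<comment> \<open>The supremum may be -\<infinity> (empty \<open>K\<close>), so a real level
      strictly between is chosen; subtracting \<open>c\<close> moves it to 0.\<close>
    then obtain c where c: "(SUP w\<in>K. ereal (u w)) < ereal c" "c < u y"
      using ereal_dense2[OF u(2)] by auto
    have "u z \<le> c" if "z \<in> hull_of \<Gamma> K" for z
    proof -
      have "ereal (u z) \<le> (SUP w\<in>K. ereal (u w))" using that u(1) by (auto simp: hull_of_def)
      then have "ereal (u z) < ereal c" using c(1) by (rule le_less_trans)
      then show ?thesis by simp
    qed
    then show ?thesis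
      using c u(1) psh_class_add[OF u(1) psh_class_const[of "-c"]]
      by (intro bexI[of _ "\<lambda>z. u z + (- c)"]) auto
  qed
  then obtain u where u: "\<And>y. y \<in> S \<Longrightarrow> u y \<in> psh_class \<Gamma>" "\<And>y. y \<in> S \<Longrightarrow> 0 < u y y"
    "\<And>y z. y \<in> S \<Longrightarrow> z \<in> hull_of \<Gamma> K \<Longrightarrow> u y z \<le> 0"
    by metis
  have op: "open {z. 0 < u y z}" if "y \<in> S" for y
    by (intro open_Collect_less continuous_on_const psh_class_continuous[OF u(1)[OF that]])
  have "S \<subseteq> (\<Union>y\<in>S. {z. 0 < u y z})" using u(2) by auto
  then obtain I where I: "I \<subseteq> S" "finite I" "S \<subseteq> (\<Union>y\<in>I. {z. 0 < u y z})"
    using compactE_image[where C = S and f = "\<lambda>y. {z. 0 < u y z}", OF assms(1) op] by blast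
  define \<phi> where "\<phi> = (\<lambda>z. \<Sum>y\<in>I. chi (u y z))"
  have \<phi>: "\<phi> \<in> psh_class \<Gamma>"
    unfolding \<phi>_def using I u by (intro psh_class_sum psh_class_chi) auto
  have pos: "0 < \<phi> z" if z: "z \<in> S" for z
  proof -
    obtain y where "y \<in> I" "0 < u y z" using subsetD[OF I(3) z] by auto
    then show ?thesis
      unfolding \<phi>_def using I(2) by (intro sum_pos2[of I y] chi_pos chi_nonneg) auto
  qed
  \<comment> \<open>Since \<open>\<phi>\<close> is positive on the compact set \<open>S\<close>, the
    quotient is bounded there, and a bound serves as the multiple of \<open>\<phi>\<close>.\<close>
  have "compact ((\<lambda>z. g z / \<phi> z) ` S)"
    using pos assms by (intro compact_continuous_image continuous_intros psh_class_continuous[OF \<phi>]) force+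
  then obtain A where A: "\<And>z. z \<in> S \<Longrightarrow> \<bar>g z / \<phi> z\<bar> < A" "0 < A"
    using bounded_pos_less[of "(\<lambda>z. g z / \<phi> z) ` S"] by (auto dest: compact_imp_bounded)
  show ?thesis
  proof
    show "(\<lambda>z. A * \<phi> z) \<in> psh_class \<Gamma>" using \<phi> A by (intro psh_class_scale) auto
    show "0 \<le> A * \<phi> z" for z
      using A(2) by (auto simp: \<phi>_def intro!: sum_nonneg chi_nonneg mult_nonneg_nonneg)
    show "A * \<phi> z = 0" if "z \<in> hull_of \<Gamma> K" for z
      using u(3) I(1) that by (auto simp: \<phi>_def intro!: sum.neutral chi_nonpos)
    show "g z < A * \<phi> z" if "z \<in> S" for z
      using A(1)[OF that] pos[OF that] by (simp add: abs_less_iff pos_divide_less_eq)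
  qed
qed

section \<open>The principle for members of the class\<close>

lemma psh_class_local_maximum_principle:
  assumes "open U" "compact (closure U)" "u \<in> psh_class \<Gamma>" "x \<in> U \<inter> hull_of \<Gamma> K"
    and lt: "\<And>z. z \<in> (frontier U \<inter> hull_of \<Gamma> K) \<union> (U \<inter> K) \<Longrightarrow> u z < c"
  shows "u x \<le> c"
proof (rule ccontr)
  assume "\<not> u x \<le> c"
  define g where "g = (\<lambda>z. u z + (- c))"
  have g: "g \<in> psh_class \<Gamma>"
    unfolding g_def by (intro psh_class_add psh_class_const assms)
  \<comment> \<open>Only on \<open>S\<close> must \<open>\<psi>\<close> be made large: on the rest
    of the frontier \<open>g < 0 \<le> \<psi>\<close>.\<close>
  define S where "S = frontier U \<inter> {z. 0 \<le> g z}"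
  have "compact (frontier U)"
    using assms(2) by (auto simp: compact_eq_bounded_closed intro: bounded_subset simp: frontier_def)
  moreover have "closed {z. 0 \<le> g z}"
    by (intro closed_Collect_le continuous_on_const psh_class_continuous[OF g])
  ultimately have "compact S" unfolding S_def by (rule compact_Int_closed)
  moreover have "S \<inter> hull_of \<Gamma> K = {}"
    using lt by (force simp: S_def g_def)
  ultimately obtain \<psi> where \<psi>: "\<psi> \<in> psh_class \<Gamma>" "\<And>z. 0 \<le> \<psi> z"
    "\<And>z. z \<in> hull_of \<Gamma> K \<Longrightarrow> \<psi> z = 0" "\<And>z. z \<in> S \<Longrightarrow> g z < \<psi> z"
    using separate_from_hull[OF _ _ psh_class_continuous[OF g]] by metis
  define w where "w = (\<lambda>z. \<psi> z + (if z \<in> U then chi (g z - \<psi> z) else 0))"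
  have "g z < \<psi> z" if "z \<in> frontier U" for z
    using \<psi>(2)[of z] \<psi>(4)[of z] that by (cases "0 \<le> g z") (auto simp: S_def)
  then have "w \<in> psh_class \<Gamma>"
    unfolding w_def using g \<psi>(1) \<open>open U\<close> by (intro psh_class_glue)
  then have "ereal (w x) \<le> (SUP z\<in>K. ereal (w z))"
    using assms(4) by (auto simp: hull_of_def)
  \<comment> \<open>\<open>K\<close> lies in the hull, so \<open>\<psi>\<close> vanishes on it, and
    \<open>g < 0\<close> on \<open>U \<inter> K\<close>. Hence \<open>w\<close> vanishes on
    \<open>K\<close>; for empty \<open>K\<close> the supremum is -\<infinity>.\<close>
  also have "\<dots> \<le> 0"
  proof (rule SUP_least)
    fix z assume "z \<in> K"
    then have "\<psi> z = 0" "z \<in> U \<Longrightarrow> g z \<le> 0"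
      using \<psi>(3) subset_hull_of lt by (fastforce simp: g_def)+
    then show "ereal (w z) \<le> 0" by (simp add: w_def)
  qed
  finally have "w x \<le> 0" by simp
  \<comment> \<open>As \<open>x\<close> is in the hull, \<open>\<psi> x = 0\<close> and
    \<open>w x = chi (g x)\<close> with \<open>g x > 0\<close>.\<close>
  moreover have "0 < w x"
    using \<psi>(3)[of x] assms(4) \<open>\<not> u x \<le> c\<close> by (simp add: w_def g_def chi_pos)
  ultimately show False by simp
qed

section \<open>Passage to decreasing limits\<close>

text \<open>Dini's argument: the open sublevel sets grow with \<open>n\<close>, so a finite subcover
  is contained in its member of largest index.\<close>

lemma decseq_eventually_less_on_compact:
  fixes u :: "nat \<Rightarrow> 'a::topological_space \<Rightarrow> real"
  assumes "compact L" "\<And>n. continuous_on UNIV (u n)" "\<And>z. decseq (\<lambda>n. u n z)"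
    and "\<And>z. z \<in> L \<Longrightarrow> \<exists>n. u n z < c"
  obtains n where "\<And>z. z \<in> L \<Longrightarrow> u n z < c"
proof -
  have "L \<subseteq> (\<Union>n\<in>UNIV. {z. u n z < c})" using assms by auto
  moreover have "open {z. u n z < c}" for n
    by (intro open_Collect_less continuous_on_const assms)
  ultimately obtain I where I: "finite I" "L \<subseteq> (\<Union>n\<in>I. {z. u n z < c})"
    using compactE_image[OF assms(1)] by metis
  \<comment> \<open>The witness is \<open>Max I\<close>. \<open>I\<close> can be empty only if
    \<open>L\<close> is, and then there is no \<open>z\<close> to check.\<close>
  show ?thesis
  proof
    fix z assume "z \<in> L"
    then obtain n where "n \<in> I" "u n z < c" using I by auto
    moreover have "u (Max I) z \<le> u n z"
      using decseqD[OF assms(3)] Max_ge[OF I(1)] \<open>n \<in> I\<close> by blast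
    ultimately show "u (Max I) z < c" by simp
  qed
qed

theorem corollary3p6:
  fixes \<Gamma> :: "complex^'k::finite \<Rightarrow> (complex^'k) set"
    and K U :: "(complex^'k) set"
    and v :: "complex^'k \<Rightarrow> ereal"
    and x :: "complex^'k"
  assumes "closed_cone_family \<Gamma>"
    and "compact K"
    and "open U" and "compact (closure U)"
    and "v \<in> psh_class_closure \<Gamma>"
    and "x \<in> U \<inter> hull_of \<Gamma> K"
  shows "v x \<le> (SUP y \<in> (frontier U \<inter> hull_of \<Gamma> K) \<union> (U \<inter> K). v y)"
proof (rule ccontr)
  define L where "L = (frontier U \<inter> hull_of \<Gamma> K) \<union> (U \<inter> K)"
  assume "\<not> ?thesis"
  then have "(SUP y\<in>L. v y) < v x" by (simp add: L_def)
  then obtain c where c: "(SUP y\<in>L. v y) < ereal c" "ereal c < v x"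
    using ereal_dense2 by blast
  obtain u :: "nat \<Rightarrow> complex^'k \<Rightarrow> real" where u: "\<And>n. u n \<in> psh_class \<Gamma>"
    "\<And>z. decseq (\<lambda>n. u n z)" "\<And>z. (\<lambda>n. ereal (u n z)) \<longlonglongrightarrow> v z"
    using assms(5) by (auto simp: psh_class_closure_def)
  have "closure U = U \<union> frontier U"
    using \<open>open U\<close> closure_subset[of U] by (auto simp: frontier_def interior_open)
  \<comment> \<open>Passing from \<open>U\<close> to \<open>closure U\<close> adds only points of
    \<open>frontier U \<inter> K\<close>, which are in the first set because \<open>K\<close> lies
    in the hull. In this form \<open>L\<close> is visibly compact.\<close>
  then have L_eq: "L = (frontier U \<inter> hull_of \<Gamma> K) \<union> (closure U \<inter> K)"
    using subset_hull_of[of K \<Gamma>] by (auto simp: L_def)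
  have "compact (frontier U)"
    using assms(4) by (auto simp: compact_eq_bounded_closed intro: bounded_subset simp: frontier_def)
  then have "compact L"
    unfolding L_eq
    by (rule compact_Un[OF compact_Int_closed[OF _ closed_hull_of] compact_Int[OF assms(4,2)]])
  moreover have "\<exists>n. u n z < c" if "z \<in> L" for z
  proof -
    have "v z < ereal c" using c(1) SUP_upper[OF that, of v] by (rule le_less_trans[rotated])
    then have "eventually (\<lambda>n. ereal (u n z) < ereal c) sequentially"
      using u(3) by (rule order_tendstoD(2)[rotated])
    then show ?thesis by (auto simp: eventually_sequentially)
  qed
  ultimately obtain n where "\<And>z. z \<in> L \<Longrightarrow> u n z < c"
    using decseq_eventually_less_on_compact[of L u c] u(1,2) psh_class_continuous by blast
  then have "u n x \<le> c"
    using assms u(1) unfolding L_def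
    by (intro psh_class_local_maximum_principle[of U "u n" \<Gamma> x K]) auto
  \<comment> \<open>A decreasing sequence stays above its limit, so the bound on
    \<open>u n x\<close> passes to \<open>v x\<close> and contradicts
    \<open>c < v x\<close>.\<close>
  moreover have "v x \<le> ereal (u n x)"
    using u(2)[of x] by (intro LIMSEQ_le_const2[OF u(3)] exI[of _ n]) (auto dest: decseqD)
  ultimately show False using c(2) by (meson ereal_less_eq(3) leD order_trans)
qed

end
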